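(* Let $X,Y$ be compact Hausdorff spaces, let $E,F$ be Banach spaces over $\mathbb{K}$ such that $\widetilde{S}(F)$ contains at least one singleton, and let $A,B$ be $\mathbb{K}$-linear subspaces of $C(X,E)$ and $C(Y,F)$, respectively, with $\Theta(A)=X$ and $\Theta(B)=Y$. Then for any surjective (not necessarily linear) isometry $T:A\to B$ there exist a continuous map $\Phi:Y\to X$ and a family $\{V_y\}_{y\in Y}$ of real-linear operators from $E$ to $F$ with $\|V_y\|\le 1$ for all $y\in Y$, such that $$Tf(y)=T0(y)+V_y(f(\Phi(y)))\qquad (f\in A,\ y\in Y).$$ If, in addition, $\widetilde{S}(E)$ also contains a singleton, then $\Phi$ is a homeomorphism and all the $V_y$ are isometries.
   Context: $\mathbb{K}$ denotes $\mathbb{R}$ or $\mathbb{C}$. $C(X,E)$ is the Banach space of continuous $E$-valued functions on $X$ with the supremum norm $\|\cdot\|_\infty$. An isometry is a map with $\|Tf-Tg\|_\infty=\|f-g\|_\infty$ for all $f,g\in A$. For a normed space $\mathcal{E}$, $S(\mathcal{E})$ is its unit sphere $\{u\in\mathcal{E}:\|u\|=1\}$, and $\widetilde{S}(\mathcal{E})$ is the collection of all maximal (with respect to inclusion) convex subsets of $S(\mathcal{E})$. For a $\mathbb{K}$-subspace $A$ of $C(X,E)$, a point $x\in X$ is a strong boundary point of $A$ if for each neighborhood $U$ of $x$, each $\epsilon>0$ and each $u\in S(E)$ there is $f\in A$ with $\|f\|_\infty=1$, $f(x)=u$ and $\|f(z)\|<\epsilon$ for all $z\in X\setminus U$; $\Theta(A)$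 is the set of all strong boundary points of $A$ (and similarly for $B\subseteq C(Y,F)$). *)

theory Defs
  imports "HOL-Analysis.Analysis"
begin

(* The scalar fields: normed real algebras isometrically isomorphic to the reals or to the
   complex numbers, so that a type variable of this class ranges over both cases. *)
class real_or_complex = real_normed_field +
  assumes real_or_complex:
    "\<exists>\<phi> :: 'a \<Rightarrow> complex.
       (\<forall>a b. \<phi> (a + b) = \<phi> a + \<phi> b) \<and> (\<forall>r a. \<phi> (r *\<^sub>R a) = r *\<^sub>R \<phi> a) \<and>
       (\<forall>a b. \<phi> (a * b) = \<phi> a * \<phi> b) \<and> (\<forall>a. norm (\<phi> a) = norm a) \<and>
       (range \<phi> = \<real> \<or> range \<phi> = UNIV)"

instance real :: real_or_complex
proof
  show "\<exists>\<phi> :: real \<Rightarrow> complex.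
       (\<forall>a b. \<phi> (a + b) = \<phi> a + \<phi> b) \<and> (\<forall>r a. \<phi> (r *\<^sub>R a) = r *\<^sub>R \<phi> a) \<and>
       (\<forall>a b. \<phi> (a * b) = \<phi> a * \<phi> b) \<and> (\<forall>a. norm (\<phi> a) = norm a) \<and>
       (range \<phi> = \<real> \<or> range \<phi> = UNIV)"
    by (intro exI[of _ complex_of_real]) (auto simp: Reals_def scaleR_conv_of_real)
qed

instance complex :: real_or_complex
  by standard (rule exI[of _ "\<lambda>z. z"], auto)

(* Banach spaces over such a field. The library has only real Banach spaces, so the scalar
   multiplication is a parameter; it extends scaleR, and it is compatible with the norm. *)
locale banach_over = vector_space scl
  for scl :: "'k::real_or_complex \<Rightarrow> 'e::banach \<Rightarrow> 'e" +
  assumes scale_of_real: "scl (of_real r) x = r *\<^sub>R x"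
    and norm_scale: "norm (scl c x) = norm c * norm x"

lemma banach_over_scaleR: "banach_over ((*\<^sub>R) :: real \<Rightarrow> 'e::banach \<Rightarrow> 'e)"
  by unfold_locales (auto simp: algebra_simps)

lemma banach_over_complex: "banach_over ((*) :: complex \<Rightarrow> complex \<Rightarrow> complex)"
  by unfold_locales (auto simp: algebra_simps norm_mult scaleR_conv_of_real)

(* For compact X, the library type of bounded continuous functions with its supremum norm
   is C(X,E). *)
definition scale_bcontfun ::
    "('k \<Rightarrow> 'e \<Rightarrow> 'e) \<Rightarrow> 'k \<Rightarrow> ('x::topological_space \<Rightarrow>\<^sub>C 'e::real_normed_vector) \<Rightarrow> ('x \<Rightarrow>\<^sub>C 'e)"
  where "scale_bcontfun scl c f = Bcontfun (\<lambda>x. scl c (apply_bcontfun f x))"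

lemma (in banach_over) apply_scale_bcontfun [simp]:
  "apply_bcontfun (scale_bcontfun scl c f) x = scl c (apply_bcontfun f x)"
proof -
  have "bounded_linear (scl c)"
  proof (rule bounded_linear_intro[of _ "norm c"])
    show "scl c (r *\<^sub>R v) = r *\<^sub>R scl c v" for r v
      by (metis scale_of_real scale_left_commute)
  qed (simp_all add: scale_right_distrib norm_scale mult.commute)
  then have "(\<lambda>x. scl c (apply_bcontfun f x)) \<in> bcontfun"
    using bounded_linear.continuous_on[OF _ continuous_on_apply_bcontfun]
      bounded_linear_image[OF bounded_apply_bcontfun, of "scl c" f]
    by (simp add: bcontfun_def image_image)
  then show ?thesis
    by (simp add: scale_bcontfun_def Bcontfun_inverse)
qed

definition subspace_over ::
    "('k::real_or_complex \<Rightarrow> 'e \<Rightarrow> 'e) \<Rightarrow> ('x::topological_space \<Rightarrow>\<^sub>C 'e::real_normed_vector) set \<Rightarrow> bool"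
  where "subspace_over scl A \<longleftrightarrow> module.subspace (scale_bcontfun scl) A"

lemma (in banach_over) module_scale_bcontfun:
  "module (scale_bcontfun scl :: 'k \<Rightarrow> ('x::topological_space \<Rightarrow>\<^sub>C 'e) \<Rightarrow> _)"
  by unfold_locales
    (auto intro!: bcontfun_eqI simp: scale_right_distrib scale_left_distrib)

definition maximal_convex_sphere_sets :: "'e::real_normed_vector set set"
  where "maximal_convex_sphere_sets =
    {C. C \<subseteq> sphere 0 1 \<and> convex C \<and>
        (\<forall>D. D \<subseteq> sphere 0 1 \<and> convex D \<and> C \<subseteq> D \<longrightarrow> D = C)}"

(* The neighbourhoods of x are the sets, not necessarily open, whose interior contains x. *)
definition strong_boundary :: "('x::topological_space \<Rightarrow>\<^sub>C 'e::real_normed_vector) set \<Rightarrow> 'x set"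
  where "strong_boundary A =
    {x. \<forall>U \<epsilon> u. x \<in> interior U \<and> \<epsilon> > 0 \<and> u \<in> sphere 0 1 \<longrightarrow>
        (\<exists>f\<in>A. norm f = 1 \<and> apply_bcontfun f x = u \<and>
               (\<forall>z. z \<notin> U \<longrightarrow> norm (apply_bcontfun f z) < \<epsilon>))}"

end

theory Submission
  imports Defs
begin

text \<open>
  By the Mazur--Ulam theorem \<open>S = T - T 0\<close> is real-linear. Let \<open>{v}\<close> be a maximal convex subset of
  the sphere of \<open>F\<close> and fix \<open>y\<close>. The functions \<open>f\<close> in the unit sphere of \<open>A\<close> with \<open>S f y = v\<close> form a
  convex set, so by compactness they all attain their norm at a common point \<open>x\<close>. If \<open>c\<close> is the
  value at \<open>x\<close> of one of them, then every \<open>f\<close> in the unit sphere of \<open>A\<close> with \<open>f x = c\<close> satisfies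
  \<open>S f y = v\<close>: its image is at distance 2 from the negative of every norm-one function with value \<open>v\<close>
  at \<open>y\<close>, and averages of such functions with shrinking peaks detect \<open>\<parallel>v + S f y\<parallel> = 2\<close>, whence
  \<open>S f y = v\<close> by maximality. If now \<open>f x = 0\<close> and \<open>\<parallel>f\<parallel> \<le> 1\<close>, adding \<open>f\<close> or \<open>-f\<close> to a peak function with
  value \<open>c\<close> at \<open>x\<close> hardly increases the norm; hence \<open>v + S f y\<close> and \<open>v - S f y\<close> lie in the unit ball
  and \<open>S f y = 0\<close> because \<open>v\<close> is extreme. So \<open>S f y\<close> depends only on \<open>f x\<close>, and \<open>\<Phi> y = x\<close>. Applied
  to the inverse of \<open>S\<close>, the same argument yields the inverse of \<open>\<Phi>\<close>.
\<close>

section \<open>Mazur-Ulam theorem for isometries between subspaces\<close>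

text \<open>Conjugating a point reflection of the codomain by \<open>f\<close> doubles the failure to preserve a midpoint.
  As that failure is bounded for all isometries at once, iterating forces it to be 0.\<close>

lemma isometry_reflect_midpoint:
  fixes f :: "'a::real_normed_vector \<Rightarrow> 'b::real_normed_vector"
  assumes A: "subspace A" and B: "subspace B" and surj: "f ` A = B"
    and iso: "\<And>x y. x \<in> A \<Longrightarrow> y \<in> A \<Longrightarrow> norm (f x - f y) = norm (x - y)"
    and a: "a \<in> A" and b: "b \<in> A"
  obtains h where "h ` A = A" and "\<And>x y. x \<in> A \<Longrightarrow> y \<in> A \<Longrightarrow> norm (h x - h y) = norm (x - y)"
    and "h a = b" and "h b = a"
    and "norm (h ((1/2) *\<^sub>R (a + b)) - (1/2) *\<^sub>R (h a + h b)) =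
      2 * norm (f ((1/2) *\<^sub>R (a + b)) - (1/2) *\<^sub>R (f a + f b))"
proof -
  define g where "g = inv_into A f"
  have inj: "inj_on f A"
    using iso by (fastforce intro: inj_onI)
  have gf: "g (f x) = x" if "x \<in> A" for x
    using inj that by (simp add: g_def)
  have gA: "g u \<in> A" and fg: "f (g u) = u" if "u \<in> B" for u
    using surj that by (auto simp: g_def inv_into_into f_inv_into_f)
  have giso: "norm (g u - g w) = norm (u - w)" if "u \<in> B" "w \<in> B" for u w
    using iso[of "g u" "g w"] that gA fg by simp
  have fB: "f x \<in> B" if "x \<in> A" for x
    using surj that by auto
  define h where "h x = g (f a + f b - f x)" for x
  define m where "m = (1/2) *\<^sub>R (a + b)"
  have m: "m \<in> A"
    using A a b by (simp add: m_def subspace_add subspace_scale)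
  have r: "f a + f b - f x \<in> B" if "x \<in> A" for x
    using B a b that fB by (simp add: subspace_add subspace_diff)
  have "h ` A \<subseteq> A"
    using gA r by (auto simp: h_def)
  moreover have "x \<in> h ` A" if "x \<in> A" for x
  proof
    show "h x \<in> A" using gA r that by (simp add: h_def)
    show "x = h (h x)"
      unfolding h_def using r[OF that] by (simp add: fg gf that)
  qed
  ultimately have 1: "h ` A = A" by auto
  have 2: "norm (h x - h y) = norm (x - y)" if "x \<in> A" "y \<in> A" for x y
    using that r iso[OF that] by (simp add: h_def giso norm_minus_commute)
  have 3: "h a = b" "h b = a"
    using a b by (auto simp: h_def gf)
  \<comment> \<open>As \<open>h\<close> exchanges \<open>a\<close> and \<open>b\<close>, the
    midpoint of \<open>h a\<close> and \<open>h b\<close> is \<open>m\<close> again, so this is the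
    defect of \<open>h\<close>.\<close>
  have "norm (h m - m) = norm (g (f a + f b - f m) - g (f m))"
    using m by (simp add: h_def gf)
  also have "\<dots> = norm (f a + f b - f m - f m)"
    using m r fB by (intro giso) auto
  also have "f a + f b - f m - f m = (-2) *\<^sub>R (f m - (1/2) *\<^sub>R (f a + f b))"
    by (simp add: algebra_simps scaleR_2)
  also have "norm \<dots> = 2 * norm (f m - (1/2) *\<^sub>R (f a + f b))"
    by (subst norm_scaleR) simp
  finally show thesis
    using that[of h] 1 2 3 by (simp add: m_def add.commute)
qed

text \<open>The bound does not mention \<open>g\<close>, so the induction may replace
  \<open>g\<close> by its reflected isometry, which has twice the defect. For \<open>n = 0\<close>,
  the image of the midpoint is at distance \<open>norm (a - b) / 2\<close> from both
  \<open>g a\<close> and \<open>g b\<close>.\<close>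

lemma self_isometry_midpoint_defect:
  fixes g :: "'a::real_normed_vector \<Rightarrow> 'a"
  assumes A: "subspace A" and a: "a \<in> A" and b: "b \<in> A"
    and "g ` A = A"
    and "\<And>x y. x \<in> A \<Longrightarrow> y \<in> A \<Longrightarrow> norm (g x - g y) = norm (x - y)"
  shows "2 ^ n * norm (g ((1/2) *\<^sub>R (a + b)) - (1/2) *\<^sub>R (g a + g b)) \<le> norm (a - b)"
  using assms(4,5)
proof (induction n arbitrary: g)
  case 0
  define m where "m = (1/2) *\<^sub>R (a + b)"
  have m: "m \<in> A"
    using A a b by (simp add: m_def subspace_add subspace_scale)
  have ma: "m - a = (1/2) *\<^sub>R (b - a)" and mb: "m - b = (1/2) *\<^sub>R (a - b)"
    using scaleR_add_left[of "1/2" "1/2" a] scaleR_add_left[of "1/2" "1/2" b]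
    by (simp_all add: m_def algebra_simps)
  have "g m - (1/2) *\<^sub>R (g a + g b) = (1/2) *\<^sub>R (g m - g a) + (1/2) *\<^sub>R (g m - g b)"
    using scaleR_add_left[of "1/2" "1/2" "g m"] by (simp add: algebra_simps)
  also have "norm \<dots> \<le> norm ((1/2) *\<^sub>R (g m - g a)) + norm ((1/2) *\<^sub>R (g m - g b))"
    by (rule norm_triangle_ineq)
  also have "\<dots> = norm (a - b) / 2"
    using 0(2)[OF m a] 0(2)[OF m b] by (simp add: ma mb norm_minus_commute)
  also have "\<dots> \<le> norm (a - b)" by simp
  finally show ?case by (simp add: m_def)
next
  case (Suc n)
  obtain h where h: "h ` A = A" "\<And>x y. x \<in> A \<Longrightarrow> y \<in> A \<Longrightarrow> norm (h x - h y) = norm (x - y)"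
    and *: "norm (h ((1/2) *\<^sub>R (a + b)) - (1/2) *\<^sub>R (h a + h b)) =
      2 * norm (g ((1/2) *\<^sub>R (a + b)) - (1/2) *\<^sub>R (g a + g b))"
    using isometry_reflect_midpoint[OF A A Suc.prems a b] by metis
  show ?case
    using Suc.IH[OF h] unfolding * by (simp add: mult.commute mult.left_commute)
qed

lemma isometry_midpoint:
  fixes f :: "'a::real_normed_vector \<Rightarrow> 'b::real_normed_vector"
  assumes A: "subspace A" and B: "subspace B" and surj: "f ` A = B"
    and iso: "\<And>x y. x \<in> A \<Longrightarrow> y \<in> A \<Longrightarrow> norm (f x - f y) = norm (x - y)"
    and a: "a \<in> A" and b: "b \<in> A"
  shows "f ((1/2) *\<^sub>R (a + b)) = (1/2) *\<^sub>R (f a + f b)"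
proof -
  \<comment> \<open>The doubling argument needs a map of \<open>A\<close> to itself; one reflection
    turns \<open>f\<close> into such a map at the cost of a factor 2.\<close>
  obtain h where h: "h ` A = A" "\<And>x y. x \<in> A \<Longrightarrow> y \<in> A \<Longrightarrow> norm (h x - h y) = norm (x - y)"
    and *: "norm (h ((1/2) *\<^sub>R (a + b)) - (1/2) *\<^sub>R (h a + h b)) =
      2 * norm (f ((1/2) *\<^sub>R (a + b)) - (1/2) *\<^sub>R (f a + f b))"
    using isometry_reflect_midpoint[OF A B surj iso a b] by metis
  define d where "d = norm (f ((1/2) *\<^sub>R (a + b)) - (1/2) *\<^sub>R (f a + f b))"
  have bound: "2 ^ n * (2 * d) \<le> norm (a - b)" for n
    using self_isometry_midpoint_defect[OF A a b h, of n] unfolding * d_def .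
  have "d = 0"
  proof (rule ccontr)
    assume "d \<noteq> 0"
    then have d: "d > 0" by (simp add: d_def)
    obtain n where "norm (a - b) / (2 * d) < 2 ^ n"
      using real_arch_pow[of 2] by auto
    then show False
      using bound[of n] d by (simp add: field_simps)
  qed
  then show ?thesis by (simp add: d_def)
qed

text \<open>The deviation \<open>\<psi>\<close> from linearity is additive and vanishes at the
  integers, so its values are those at fractional parts and hence bounded. A nonzero value would
  have unbounded integer multiples.\<close>

lemma bounded_additive_homogeneous:
  fixes \<phi> :: "real \<Rightarrow> 'b::real_normed_vector"
  assumes add: "\<And>s t. \<phi> (s + t) = \<phi> s + \<phi> t" and bound: "\<And>t. norm (\<phi> t) \<le> K * \<bar>t\<bar>"
  shows "\<phi> t = t *\<^sub>R \<phi> 1"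
proof -
  define \<psi> where "\<psi> t = \<phi> t - t *\<^sub>R \<phi> 1" for t
  interpret additive \<psi>
    by unfold_locales (simp add: \<psi>_def add algebra_simps)
  have nat: "\<psi> (real n * t) = real n *\<^sub>R \<psi> t" for n t
    by (induction n) (simp_all add: zero distrib_right add scaleR_add_left)
  have nat1: "\<psi> (real n) = 0" for n
    using nat[of n 1] by (simp add: \<psi>_def)
  have int1: "\<psi> (of_int k) = 0" for k
    by (cases k rule: int_cases2) (simp_all add: nat1 minus)
  have bounded: "norm (\<psi> t) \<le> 2 * K" for t
  proof -
    have K: "K \<ge> 0"
      using order_trans[OF norm_ge_zero bound[of 1]] by simp
    have "\<psi> t = \<psi> (of_int \<lfloor>t\<rfloor>) + \<psi> (frac t)"
      by (metis add add.commute frac_def diff_add_cancel)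
    then have "norm (\<psi> t) = norm (\<phi> (frac t) - frac t *\<^sub>R \<phi> 1)"
      by (simp add: int1) (simp add: \<psi>_def)
    also have "\<dots> \<le> norm (\<phi> (frac t)) + norm (frac t *\<^sub>R \<phi> 1)"
      by (rule norm_triangle_ineq4)
    also have "\<dots> \<le> K * 1 + 1 * K"
    proof (intro add_mono)
      show "norm (\<phi> (frac t)) \<le> K * 1"
        using bound[of "frac t"] mult_left_mono[OF less_imp_le[OF frac_lt_1] K, of t] by simp
      show "norm (frac t *\<^sub>R \<phi> 1) \<le> 1 * K"
        using mult_mono[OF less_imp_le[OF frac_lt_1[of t]] bound[of 1]] by simp
    qed
    finally show ?thesis by simp
  qed
  have "\<psi> t = 0"
  proof (rule ccontr)
    assume "\<psi> t \<noteq> 0"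
    then have "norm (\<psi> t) > 0" by simp
    then obtain n where "2 * K < real n * norm (\<psi> t)"
      by (metis reals_Archimedean3)
    then show False
      using bounded[of "real n * t"] by (simp add: nat)
  qed
  then show ?thesis by (simp add: \<psi>_def)
qed

text \<open>Midpoints with 0 give compatibility with halving, and general midpoints then give
  additivity. Along each line the isometry bounds the growth, which upgrades additivity to real
  homogeneity.\<close>

lemma mazur_ulam_subspace:
  fixes f :: "'a::real_normed_vector \<Rightarrow> 'b::real_normed_vector"
  assumes A: "subspace A" and B: "subspace B" and surj: "f ` A = B"
    and iso: "\<And>x y. x \<in> A \<Longrightarrow> y \<in> A \<Longrightarrow> norm (f x - f y) = norm (x - y)"
    and zero: "f 0 = 0"
  shows "\<And>a b. a \<in> A \<Longrightarrow> b \<in> A \<Longrightarrow> f (a + b) = f a + f b"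
    and "\<And>a r. a \<in> A \<Longrightarrow> f (r *\<^sub>R a) = r *\<^sub>R f a"
proof -
  have half: "f ((1/2) *\<^sub>R a) = (1/2) *\<^sub>R f a" if "a \<in> A" for a
    using isometry_midpoint[OF A B surj iso that subspace_0[OF A]] by (simp add: zero)
  show add: "f (a + b) = f a + f b" if "a \<in> A" "b \<in> A" for a b
    using isometry_midpoint[OF A B surj iso that] half[OF subspace_add[OF A that]] by simp
  show "f (r *\<^sub>R a) = r *\<^sub>R f a" if "a \<in> A" for a r
  proof -
    have "f (r *\<^sub>R a) = r *\<^sub>R f (1 *\<^sub>R a)"
    proof (rule bounded_additive_homogeneous[of "\<lambda>r. f (r *\<^sub>R a)" "norm a"])
      show "f ((s + t) *\<^sub>R a) = f (s *\<^sub>R a) + f (t *\<^sub>R a)" for s t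
        using that A by (simp add: scaleR_add_left add subspace_scale)
      show "norm (f (t *\<^sub>R a)) \<le> norm a * \<bar>t\<bar>" for t
        using iso[of "t *\<^sub>R a" 0] that A by (simp add: subspace_scale subspace_0 zero mult.commute)
    qed
    then show ?thesis by simp
  qed
qed

section \<open>Singleton maximal convex sets, peak functions and norming points\<close>

text \<open>If \<open>norm (v + w) = 2\<close>, the whole segment from \<open>v\<close> to
  \<open>w\<close> lies in the sphere, and maximality of \<open>{v}\<close> collapses it to a
  point.\<close>

lemma maximal_convex_singletonD:
  assumes v: "{v} \<in> maximal_convex_sphere_sets"
  shows "norm v = 1"
    and "\<And>w. norm w \<le> 1 \<Longrightarrow> norm (v + w) = 2 \<Longrightarrow> w = v"
proof -
  show nv: "norm v = 1"
    using v by (simp add: maximal_convex_sphere_sets_def)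
  fix w assume w: "norm w \<le> 1" "norm (v + w) = 2"
  have "norm ((1 - t) *\<^sub>R v + t *\<^sub>R w) = 1" if t: "0 \<le> t" "t \<le> 1" for t
  proof -
    have le: "norm ((1 - s) *\<^sub>R v + s *\<^sub>R w) \<le> 1" if s: "0 \<le> s" "s \<le> 1" for s
      using convex_cball[of "0::'a" 1, unfolded convex_alt] s w nv by simp
    \<comment> \<open>The points with parameters \<open>t\<close> and \<open>1 - t\<close> add up to
      \<open>v + w\<close>; both have norm at most 1, so neither can be shorter than 1.\<close>
    have "v + w = ((1 - t) *\<^sub>R v + t *\<^sub>R w) + ((1 - (1 - t)) *\<^sub>R v + (1 - t) *\<^sub>R w)"
      by (simp add: algebra_simps)
    then have "2 \<le> norm ((1 - t) *\<^sub>R v + t *\<^sub>R w) + norm ((1 - (1 - t)) *\<^sub>R v + (1 - t) *\<^sub>R w)"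
      using w norm_triangle_ineq by metis
    then show ?thesis
      using le[of t] le[of "1 - t"] t by simp
  qed
  then have "closed_segment v w \<subseteq> sphere 0 1"
    by (auto simp: closed_segment_def)
  then have "closed_segment v w = {v}"
    using v by (simp add: maximal_convex_sphere_sets_def)
  then show "w = v"
    using ends_in_segment(2)[of w v] by auto
qed

lemma strong_boundaryD:
  assumes "x \<in> strong_boundary A" "open U" "x \<in> U" "\<epsilon> > 0" "norm u = 1"
  obtains f where "f \<in> A" "norm f = 1" "apply_bcontfun f x = u"
    "\<And>z. z \<notin> U \<Longrightarrow> norm (apply_bcontfun f z) < \<epsilon>"
proof -
  have "x \<in> interior U \<and> \<epsilon> > 0 \<and> u \<in> sphere 0 1"
    using assms by (simp add: interior_open)
  then show thesis
    using assms(1) that unfolding strong_boundary_def by blast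
qed

text \<open>Only the prescribed value of a peak function matters here, so the neighbourhood is the
  whole space. Keeping the norm of \<open>u\<close> is what later makes the operators
  \<open>V y\<close> contractions.\<close>

lemma strong_boundary_value:
  fixes A :: "('x::topological_space \<Rightarrow>\<^sub>C 'e::real_normed_vector) set"
  assumes "subspace A" "x \<in> strong_boundary A"
  obtains f where "f \<in> A" "norm f = norm u" "apply_bcontfun f x = u"
proof (cases "u = 0")
  case True
  then show ?thesis using that[of 0] assms by (simp add: subspace_0)
next
  case False
  obtain f where f: "f \<in> A" "norm f = 1" "apply_bcontfun f x = (1 / norm u) *\<^sub>R u"
    using strong_boundaryD[OF assms(2) open_UNIV _ zero_less_one, of "(1 / norm u) *\<^sub>R u"] False
    by auto
  then show ?thesis
    using that[of "norm u *\<^sub>R f"] assms False by (simp add: subspace_scale)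
qed

text \<open>As the subspace need not be complete, a finite sum of functions with nested peaks replaces the
  usual infinite series. At each point all but one of the summands are close to \<open>v\<close> or close to 0,
  whence the error term 1.\<close>

lemma peak_sum_near_segment:
  fixes B :: "('y::topological_space \<Rightarrow>\<^sub>C 'f::real_normed_vector) set"
  assumes B: "subspace B" and y: "y \<in> strong_boundary B" and v: "norm v = 1"
    and U: "open U" "y \<in> U" and \<epsilon>: "\<epsilon> > 0"
  shows "\<exists>h\<in>B. apply_bcontfun h y = real n *\<^sub>R v \<and> norm h \<le> real n \<and>
    (\<forall>z. \<exists>s. 0 \<le> s \<and> s \<le> real n \<and> (z \<notin> U \<longrightarrow> s = 0) \<and>
       norm (apply_bcontfun h z - s *\<^sub>R v) \<le> 1 + real n * \<epsilon>)"
proof (induction n)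
  case 0
  show ?case
    using B by (intro bexI[of _ 0]) (auto simp: subspace_0)
next
  case (Suc n)
  then obtain h where h: "h \<in> B" "apply_bcontfun h y = real n *\<^sub>R v" "norm h \<le> real n"
    and near: "\<And>z. \<exists>s. 0 \<le> s \<and> s \<le> real n \<and> (z \<notin> U \<longrightarrow> s = 0) \<and>
       norm (apply_bcontfun h z - s *\<^sub>R v) \<le> 1 + real n * \<epsilon>"
    by blast
  \<comment> \<open>The next peak is confined to where the partial sum is already close to its value
    at \<open>y\<close>. Inside \<open>W\<close> only the new summand is uncontrolled; outside
    \<open>W\<close> it adds less than \<open>\<epsilon>\<close>.\<close>
  define W where "W = U \<inter> {z. norm (apply_bcontfun h z - real n *\<^sub>R v) < \<epsilon>}"
  have "open W"
    unfolding W_def using U by (intro open_Int open_Collect_less continuous_intros) auto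
  moreover have "y \<in> W"
    using U \<epsilon> h by (simp add: W_def)
  ultimately obtain p where p: "p \<in> B" "norm p = 1" "apply_bcontfun p y = v"
    "\<And>z. z \<notin> W \<Longrightarrow> norm (apply_bcontfun p z) < \<epsilon>"
    using strong_boundaryD[OF y _ _ \<epsilon> v] by blast
  have "\<exists>s. 0 \<le> s \<and> s \<le> real (Suc n) \<and> (z \<notin> U \<longrightarrow> s = 0) \<and>
       norm (apply_bcontfun (h + p) z - s *\<^sub>R v) \<le> 1 + real (Suc n) * \<epsilon>" for z
  proof (cases "z \<in> W")
    case True
    then have "norm (apply_bcontfun h z - real n *\<^sub>R v) < \<epsilon>" "z \<in> U"
      by (auto simp: W_def)
    moreover have "norm (apply_bcontfun p z) \<le> 1"
      using norm_bounded[of p z] p by simp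
    moreover have "norm (apply_bcontfun (h + p) z - real n *\<^sub>R v) \<le>
        norm (apply_bcontfun h z - real n *\<^sub>R v) + norm (apply_bcontfun p z)"
      by (metis add_diff_eq diff_add_eq norm_triangle_ineq plus_bcontfun.rep_eq)
    moreover have "\<epsilon> \<le> real (Suc n) * \<epsilon>"
      using \<epsilon> by simp
    ultimately have "norm (apply_bcontfun (h + p) z - real n *\<^sub>R v) \<le> 1 + real (Suc n) * \<epsilon>"
      by linarith
    with \<open>z \<in> U\<close> show ?thesis
      by (intro exI[of _ "real n"]) auto
  next
    case False
    obtain s where s: "0 \<le> s" "s \<le> real n" "z \<notin> U \<longrightarrow> s = 0"
       "norm (apply_bcontfun h z - s *\<^sub>R v) \<le> 1 + real n * \<epsilon>"
      using near by blast
    moreover have "norm (apply_bcontfun (h + p) z - s *\<^sub>R v) \<le>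
        norm (apply_bcontfun h z - s *\<^sub>R v) + norm (apply_bcontfun p z)"
      by (metis add_diff_eq diff_add_eq norm_triangle_ineq plus_bcontfun.rep_eq)
    ultimately show ?thesis
      using p(4)[OF False] by (intro exI[of _ s]) (auto simp: distrib_right)
  qed
  moreover have "norm (h + p) \<le> real (Suc n)"
    using norm_triangle_ineq[of h p] h p by simp
  ultimately show ?case
    using h p B by (intro bexI[of _ "h + p"]) (auto simp: subspace_add scaleR_add_left)
qed

text \<open>Otherwise an average \<open>k\<close> of peak functions has norm 1 and value
  \<open>v\<close> at \<open>y\<close>, yet \<open>norm (g + k) < 2\<close>: near \<open>y\<close>
  the function \<open>g\<close> hardly varies and \<open>k\<close> stays close to the segment from 0
  to \<open>v\<close>, elsewhere \<open>k\<close> is small.\<close>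

lemma norm_add_peak_value:
  fixes B :: "('y::topological_space \<Rightarrow>\<^sub>C 'f::real_normed_vector) set"
  assumes B: "subspace B" and y: "y \<in> strong_boundary B" and v: "norm v = 1"
    and g: "norm g \<le> 1"
    and far: "\<And>h. h \<in> B \<Longrightarrow> norm h = 1 \<Longrightarrow> apply_bcontfun h y = v \<Longrightarrow> norm (g + h) = 2"
  shows "norm (v + apply_bcontfun g y) = 2"
proof (rule ccontr)
  assume ne: "norm (v + apply_bcontfun g y) \<noteq> 2"
  have gz: "norm (apply_bcontfun g z) \<le> 1" for z
    using norm_bounded[of g z] g by simp
  \<comment> \<open>The cap at 1 gives \<open>1 \<le> 2 - \<delta>\<close>, so the same bound also
    covers the terms where only \<open>norm g \<le> 1\<close> is known.\<close>
  define \<delta> where "\<delta> = min 1 (2 - norm (v + apply_bcontfun g y))"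
  have \<delta>: "\<delta> > 0" "\<delta> \<le> 1" "norm (v + apply_bcontfun g y) \<le> 2 - \<delta>"
    using ne norm_triangle_ineq[of v "apply_bcontfun g y"] gz[of y] v
    by (auto simp: \<delta>_def)
  \<comment> \<open>Of the four quarters of \<open>\<delta>\<close>, one pays for the variation of
    \<open>g\<close> on \<open>U\<close>, two for the distance of \<open>k\<close> from the segment,
    and one remains as the gap below 2.\<close>
  define \<epsilon> where "\<epsilon> = \<delta> / 4"
  have \<epsilon>: "\<epsilon> > 0" using \<delta> by (simp add: \<epsilon>_def)
  \<comment> \<open>After averaging, the error term 1 of the peak sum becomes
    \<open>1 / real n\<close>.\<close>
  obtain n where n: "n > 0" "1 / real n < \<epsilon>"
    using \<epsilon> by (metis real_arch_invD inverse_eq_divide neq0_conv)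
  define U where "U = {z. norm (apply_bcontfun g z - apply_bcontfun g y) < \<epsilon>}"
  have U: "open U" "y \<in> U"
    unfolding U_def using \<epsilon> by (auto intro!: open_Collect_less continuous_intros)
  obtain h where h: "h \<in> B" "apply_bcontfun h y = real n *\<^sub>R v" "norm h \<le> real n"
    and near: "\<And>z. \<exists>s. 0 \<le> s \<and> s \<le> real n \<and> (z \<notin> U \<longrightarrow> s = 0) \<and>
       norm (apply_bcontfun h z - s *\<^sub>R v) \<le> 1 + real n * \<epsilon>"
    using peak_sum_near_segment[OF B y v U \<epsilon>, of n] by blast
  define k where "k = (1 / real n) *\<^sub>R h"
  have ky: "apply_bcontfun k y = v"
    using h n by (simp add: k_def)
  have "norm k \<le> 1"
    using h n by (simp add: k_def field_simps)
  moreover have "1 \<le> norm k"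
    using norm_bounded[of k y] ky v by simp
  ultimately have "norm k = 1" by simp
  moreover have "k \<in> B"
    using B h by (simp add: k_def subspace_scale)
  ultimately have two: "norm (g + k) = 2"
    using far ky by blast
  have "norm (apply_bcontfun (g + k) z) \<le> 2 - \<epsilon>" for z
  proof -
    obtain s where s: "0 \<le> s" "s \<le> real n" "z \<notin> U \<longrightarrow> s = 0"
       "norm (apply_bcontfun h z - s *\<^sub>R v) \<le> 1 + real n * \<epsilon>"
      using near by blast
    define t where "t = s / real n"
    have t: "0 \<le> t" "t \<le> 1" "z \<notin> U \<longrightarrow> t = 0"
      using s n by (auto simp: t_def)
    have "apply_bcontfun k z - t *\<^sub>R v = (1 / real n) *\<^sub>R (apply_bcontfun h z - s *\<^sub>R v)"
      by (simp add: k_def t_def algebra_simps)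
    then have "norm (apply_bcontfun k z - t *\<^sub>R v) \<le> (1 / real n) * (1 + real n * \<epsilon>)"
      using mult_left_mono[OF s(4), of "1 / real n"] by simp
    also have "\<dots> = 1 / real n + \<epsilon>"
      using n by (simp add: field_simps)
    finally have 1: "norm (apply_bcontfun k z - t *\<^sub>R v) \<le> 2 * \<epsilon>"
      using n by simp
    have 2: "norm (apply_bcontfun g z + t *\<^sub>R v) \<le> 2 - 3 * \<epsilon>"
    proof (cases "z \<in> U")
      case True
      have "apply_bcontfun g z + t *\<^sub>R v = (apply_bcontfun g z - apply_bcontfun g y) +
          (t *\<^sub>R (v + apply_bcontfun g y) + (1 - t) *\<^sub>R apply_bcontfun g y)"
        by (simp add: algebra_simps)
      also have "norm \<dots> \<le> norm (apply_bcontfun g z - apply_bcontfun g y) +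
          (norm (t *\<^sub>R (v + apply_bcontfun g y)) + norm ((1 - t) *\<^sub>R apply_bcontfun g y))"
        by (meson add_left_mono norm_triangle_ineq order_trans)
      also have "\<dots> = norm (apply_bcontfun g z - apply_bcontfun g y) +
          (t * norm (v + apply_bcontfun g y) + (1 - t) * norm (apply_bcontfun g y))"
        using t by simp
      also have "\<dots> \<le> \<epsilon> + (t * (2 - \<delta>) + (1 - t) * (2 - \<delta>))"
        using True t \<delta> gz[of y] by (intro add_mono mult_left_mono) (auto simp: U_def)
      also have "\<dots> = 2 - 3 * \<epsilon>"
        by (simp add: \<epsilon>_def algebra_simps)
      finally show ?thesis .
    next
      case False
      then show ?thesis
        using t gz[of z] \<delta> by (simp add: \<epsilon>_def)
    qed
    have "apply_bcontfun (g + k) z =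
        (apply_bcontfun g z + t *\<^sub>R v) + (apply_bcontfun k z - t *\<^sub>R v)"
      by simp
    also have "norm \<dots> \<le> norm (apply_bcontfun g z + t *\<^sub>R v) + norm (apply_bcontfun k z - t *\<^sub>R v)"
      by (rule norm_triangle_ineq)
    finally show ?thesis
      using 1 2 by simp
  qed
  then have "norm (g + k) \<le> 2 - \<epsilon>"
    by (rule norm_bound)
  then show False
    using two \<epsilon> by simp
qed

text \<open>By compactness finitely many functions suffice. Their average lies in \<open>P\<close>,
  so it has norm 1 and attains it somewhere; by the triangle inequality all of them have norm 1
  there.\<close>

lemma convex_sphere_common_norming_point:
  fixes P :: "('x::topological_space \<Rightarrow>\<^sub>C 'e::real_normed_vector) set"
  assumes X: "compact (UNIV :: 'x set)" and P: "convex P" "P \<subseteq> sphere 0 1"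
  obtains x where "\<And>f. f \<in> P \<Longrightarrow> norm (apply_bcontfun f x) = 1"
proof -
  have le: "norm (apply_bcontfun f z) \<le> 1" if "f \<in> P" for f z
    using norm_bounded[of f z] P that by auto
  have "UNIV \<inter> (\<Inter>f\<in>P. {x. norm (apply_bcontfun f x) = 1}) \<noteq> {}"
  proof (rule compact_imp_fip_image[OF X])
    show "closed {x. norm (apply_bcontfun f x) = 1}" for f :: "'x \<Rightarrow>\<^sub>C 'e"
      by (intro closed_Collect_eq continuous_intros) auto
    fix I assume I: "finite I" "I \<subseteq> P"
    show "UNIV \<inter> (\<Inter>f\<in>I. {x. norm (apply_bcontfun f x) = 1}) \<noteq> {}"
    proof (cases "I = {}")
      case False
      define c where "c = 1 / real (card I)"
      have c: "c > 0" "(\<Sum>f\<in>I. c) = 1"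
        using I False by (auto simp: c_def card_gt_0_iff)
      define a where "a = (\<Sum>f\<in>I. c *\<^sub>R f)"
      have "a \<in> P"
        unfolding a_def using I c P by (intro convex_sum) auto
      then have a: "norm a = 1" using P by auto
      obtain x where x: "\<And>z. norm (apply_bcontfun a z) \<le> norm (apply_bcontfun a x)"
        using continuous_attains_sup[OF X, of "\<lambda>z. norm (apply_bcontfun a z)"]
        by (auto intro: continuous_intros)
      have app: "apply_bcontfun (\<Sum>f\<in>J. c *\<^sub>R f) x = (\<Sum>f\<in>J. c *\<^sub>R apply_bcontfun f x)"
        if "finite J" for J :: "('x \<Rightarrow>\<^sub>C 'e) set"
        using that by induction auto
      have "1 \<le> norm (apply_bcontfun a x)"
        using norm_bound[of a, OF x] a by simp
      also have "\<dots> \<le> (\<Sum>f\<in>I. norm (c *\<^sub>R apply_bcontfun f x))"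
        unfolding a_def app[OF I(1)] by (rule norm_sum)
      finally have "(\<Sum>f\<in>I. c) \<le> (\<Sum>f\<in>I. c * norm (apply_bcontfun f x))"
        using c by simp
      moreover have "c * norm (apply_bcontfun f x) \<le> c" if "f \<in> I" for f
        using le[of f x] I c that by auto
      \<comment> \<open>Each term is at most \<open>c\<close> and the sum reaches the sum of these
        bounds, so there is equality termwise.\<close>
      ultimately have "c = c * norm (apply_bcontfun f x)" if "f \<in> I" for f
        using sum_mono_inv[of "\<lambda>f. c * norm (apply_bcontfun f x)" I "\<lambda>f. c" f] I that sum_mono
        by (metis (no_types, lifting) order_antisym)
      then have "norm (apply_bcontfun f x) = 1" if "f \<in> I" for f
        using that c by fastforce
      then show ?thesis by auto
    qed simp
  qed
  then show ?thesis
    using that by auto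
qed

section \<open>Real-linear isometries as weighted composition operators\<close>

text \<open>Set up for interpretation both by \<open>S\<close> and by its inverse. Compactness
  concerns the domain space, where norms have to be attained.\<close>

locale linear_isometry_bcontfun =
  fixes A :: "('x::t2_space \<Rightarrow>\<^sub>C 'e::real_normed_vector) set"
    and B :: "('y::t2_space \<Rightarrow>\<^sub>C 'f::real_normed_vector) set"
    and S :: "('x \<Rightarrow>\<^sub>C 'e) \<Rightarrow> ('y \<Rightarrow>\<^sub>C 'f)"
  assumes compact_X: "compact (UNIV :: 'x set)"
    and A: "subspace A" and B: "subspace B"
    and boundary_A: "strong_boundary A = UNIV" and boundary_B: "strong_boundary B = UNIV"
    and surj: "S ` A = B"
    and add: "\<And>f g. f \<in> A \<Longrightarrow> g \<in> A \<Longrightarrow> S (f + g) = S f + S g"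
    and scale: "\<And>f r. f \<in> A \<Longrightarrow> S (r *\<^sub>R f) = r *\<^sub>R S f"
    and norm_S: "\<And>f. f \<in> A \<Longrightarrow> norm (S f) = norm f"
begin

lemma diff: "f \<in> A \<Longrightarrow> g \<in> A \<Longrightarrow> S (f - g) = S f - S g"
  using add[of f "(-1) *\<^sub>R g"] scale[of g "-1"] A by (simp add: subspace_neg)

text \<open>Here \<open>x\<close> is a common norming point of the convex set \<open>P\<close>, and
  \<open>c\<close> is the value there of one member \<open>f0\<close>. The property then passes from
  \<open>f0\<close> to every unit function agreeing with it at \<open>x\<close>.\<close>

lemma norming_pair:
  assumes v: "{v} \<in> maximal_convex_sphere_sets"
  obtains x c where "norm c = 1"
    "\<And>f. f \<in> A \<Longrightarrow> norm f = 1 \<Longrightarrow> apply_bcontfun f x = c \<Longrightarrow> apply_bcontfun (S f) y = v"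
proof -
  note v1 = maximal_convex_singletonD[OF v]
  define P where "P = {f \<in> A. norm f = 1 \<and> apply_bcontfun (S f) y = v}"
  have convex: "convex P"
    unfolding convex_def
  proof (intro ballI allI impI)
    fix f g and s t :: real
    assume fg: "f \<in> P" "g \<in> P" and st: "0 \<le> s" "0 \<le> t" "s + t = 1"
    let ?h = "s *\<^sub>R f + t *\<^sub>R g"
    have h: "?h \<in> A"
      using fg A by (simp add: P_def subspace_add subspace_scale)
    have hv: "apply_bcontfun (S ?h) y = v"
      using fg A st by (simp add: P_def add scale subspace_scale flip: scaleR_add_left)
    have "norm ?h \<le> norm (s *\<^sub>R f) + norm (t *\<^sub>R g)"
      by (rule norm_triangle_ineq)
    then have "norm ?h \<le> 1"
      using fg st by (simp add: P_def)
    moreover have "1 \<le> norm ?h"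
      using norm_bounded[of "S ?h" y] hv v1 norm_S[OF h] by simp
    ultimately show "?h \<in> P"
      using h hv by (simp add: P_def)
  qed
  obtain x where x: "\<And>f. f \<in> P \<Longrightarrow> norm (apply_bcontfun f x) = 1"
  proof (rule convex_sphere_common_norming_point[OF compact_X convex])
    show "P \<subseteq> sphere 0 1" by (auto simp: P_def)
  qed blast
  obtain g where g: "g \<in> B" "norm g = 1" "apply_bcontfun g y = v"
    using strong_boundary_value[OF B, of y v] boundary_B v1 by auto
  then obtain f0 where f0: "f0 \<in> P"
    using surj norm_S unfolding P_def by force
  show thesis
  proof (rule that)
    show "norm (apply_bcontfun f0 x) = 1" using x f0 .
    fix f assume f: "f \<in> A" "norm f = 1" "apply_bcontfun f x = apply_bcontfun f0 x"
    have "norm (v + apply_bcontfun (S f) y) = 2"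
    proof (rule norm_add_peak_value[OF B])
      show "y \<in> strong_boundary B" using boundary_B by simp
      show "norm v = 1" using v1 by simp
      show "norm (S f) \<le> 1" using f norm_S by simp
      fix h assume h: "h \<in> B" "norm h = 1" "apply_bcontfun h y = v"
      then obtain k where k: "k \<in> P" "S k = h"
        using surj norm_S unfolding P_def by force
      \<comment> \<open>The average of \<open>f0\<close> and \<open>k\<close> also attains norm 1 at
        \<open>x\<close>, so \<open>f0\<close> and \<open>k\<close> add there to a vector of norm 2;
        \<open>f\<close> has the same value as \<open>f0\<close> at \<open>x\<close>.\<close>
      have "(1/2) *\<^sub>R f0 + (1/2) *\<^sub>R k \<in> P"
        using convexD[OF convex f0 k(1), of "1/2" "1/2"] by simp
      then have "norm ((1/2) *\<^sub>R (apply_bcontfun f0 x + apply_bcontfun k x)) = 1"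
        using x[of "(1/2) *\<^sub>R f0 + (1/2) *\<^sub>R k"] by (simp add: scaleR_add_right)
      then have "2 = norm (apply_bcontfun (f + k) x)"
        using f by simp
      also have "\<dots> \<le> norm (f + k)" by (rule norm_bounded)
      also have "\<dots> = norm (S f + h)"
        using f k A norm_S[of "f + k"] by (simp add: P_def add subspace_add)
      finally show "norm (S f + h) = 2"
        using norm_triangle_ineq[of "S f" h] f h norm_S by simp
    qed
    then show "apply_bcontfun (S f) y = v"
      using v1(2)[of "apply_bcontfun (S f) y"] norm_bounded[of "S f" y] norm_S f by simp
  qed
qed

lemma vanishing_transfer:
  assumes v: "{v} \<in> maximal_convex_sphere_sets" and c: "norm c = 1"
    and peak: "\<And>f. f \<in> A \<Longrightarrow> norm f = 1 \<Longrightarrow> apply_bcontfun f x = c \<Longrightarrow>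
      apply_bcontfun (S f) y = v"
    and f: "f \<in> A" "apply_bcontfun f x = 0"
  shows "apply_bcontfun (S f) y = 0"
proof (cases "f = 0")
  case True
  then show ?thesis using scale[OF f(1), of 0] by simp
next
  case False
  note v1 = maximal_convex_singletonD[OF v]
  have unit: "norm (v + apply_bcontfun (S k) y) \<le> 1"
    if k: "k \<in> A" "norm k \<le> 1" "apply_bcontfun k x = 0" for k
  proof (rule field_le_epsilon)
    fix \<epsilon> :: real assume \<epsilon>: "\<epsilon> > 0"
    \<comment> \<open>With the peak inside \<open>U\<close>, at each point one of \<open>h\<close>
      and \<open>k\<close> is below \<open>\<epsilon>\<close> and the other at most 1.\<close>
    define U where "U = {z. norm (apply_bcontfun k z) < \<epsilon>}"
    have "open U" "x \<in> U"
      unfolding U_def using \<epsilon> k by (auto intro!: open_Collect_less continuous_intros)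
    then obtain h where h: "h \<in> A" "norm h = 1" "apply_bcontfun h x = c"
      "\<And>z. z \<notin> U \<Longrightarrow> norm (apply_bcontfun h z) < \<epsilon>"
      using strong_boundaryD[of x A U \<epsilon> c] boundary_A \<epsilon> c by auto
    have "norm (apply_bcontfun (h + k) z) \<le> 1 + \<epsilon>" for z
    proof -
      have "norm (apply_bcontfun (h + k) z) \<le> norm (apply_bcontfun h z) + norm (apply_bcontfun k z)"
        by (simp add: norm_triangle_ineq)
      then show ?thesis
        using h(2) h(4)[of z] k norm_bounded[of h z] norm_bounded[of k z]
        by (cases "z \<in> U") (auto simp: U_def)
    qed
    then have "norm (h + k) \<le> 1 + \<epsilon>" by (rule norm_bound)
    moreover have "v + apply_bcontfun (S k) y = apply_bcontfun (S (h + k)) y"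
      using peak[OF h(1-3)] h k add by simp
    ultimately show "norm (v + apply_bcontfun (S k) y) \<le> 1 + \<epsilon>"
      using norm_bounded[of "S (h + k)" y] norm_S[of "h + k"] h k A by (simp add: subspace_add)
  qed
  define k where "k = (1 / norm f) *\<^sub>R f"
  have k: "k \<in> A" "norm k \<le> 1" "apply_bcontfun k x = 0"
    using f A by (auto simp: k_def subspace_scale)
  have Sk: "S k = (1 / norm f) *\<^sub>R S f"
    using f by (simp add: k_def scale)
  define w where "w = apply_bcontfun (S k) y"
  have plus: "norm (v + w) \<le> 1"
    using unit[OF k] by (simp add: w_def)
  have minus: "norm (v - w) \<le> 1"
    using unit[of "(-1) *\<^sub>R k"] k A scale[OF k(1), of "-1"] by (simp add: w_def subspace_neg)
  \<comment> \<open>Two vectors of norm at most 2 add up to one of norm 4, so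
    \<open>norm (v + (v + w)) = 2\<close> and the singleton property gives
    \<open>v + w = v\<close>.\<close>
  have "2 *\<^sub>R v + 2 *\<^sub>R v = (v + (v + w)) + (v + (v - w))"
    by (simp add: scaleR_2)
  moreover have "norm (2 *\<^sub>R v + 2 *\<^sub>R v) = 4"
    using v1(1) by (simp flip: scaleR_add_left)
  ultimately have "4 \<le> norm (v + (v + w)) + norm (v + (v - w))"
    by (metis norm_triangle_ineq)
  moreover have "norm (v + (v + w)) \<le> 2" "norm (v + (v - w)) \<le> 2"
    using norm_triangle_ineq[of v "v + w"] norm_triangle_ineq[of v "v - w"] plus minus v1(1) by auto
  ultimately have "v + w = v"
    using v1(2)[OF plus] by simp
  then show ?thesis
    using False by (simp add: w_def Sk)
qed

text \<open>By linearity, vanishing at \<open>\<Phi> y\<close> forcing \<open>S f y = 0\<close>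
  means that \<open>S f y\<close> is a function of \<open>f (\<Phi> y)\<close>; this function is
  \<open>V y\<close>.\<close>

lemma weighted_composition:
  assumes "\<exists>v :: 'f. {v} \<in> maximal_convex_sphere_sets"
  obtains \<Phi> :: "'y \<Rightarrow> 'x" and V :: "'y \<Rightarrow> 'e \<Rightarrow>\<^sub>L 'f"
  where "continuous_on UNIV \<Phi>" "\<And>y. norm (V y) \<le> 1"
    "\<And>f y. f \<in> A \<Longrightarrow> apply_bcontfun (S f) y = blinfun_apply (V y) (apply_bcontfun f (\<Phi> y))"
proof -
  obtain v :: 'f where v: "{v} \<in> maximal_convex_sphere_sets"
    using assms by blast
  obtain \<Phi> c where c: "\<And>y. norm (c y) = 1"
    and peak: "\<And>f y. f \<in> A \<Longrightarrow> norm f = 1 \<Longrightarrow> apply_bcontfun f (\<Phi> y) = c y \<Longrightarrow>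
      apply_bcontfun (S f) y = v"
  proof -
    have "\<exists>x c. norm c = 1 \<and> (\<forall>f\<in>A. norm f = 1 \<longrightarrow> apply_bcontfun f x = c \<longrightarrow>
        apply_bcontfun (S f) y = v)" for y
      using norming_pair[OF v, of y] by metis
    then show thesis
      using that by metis
  qed
  have vanish: "apply_bcontfun (S f) y = 0" if "f \<in> A" "apply_bcontfun f (\<Phi> y) = 0" for f y
    using vanishing_transfer[OF v c peak that] .
  have cong: "apply_bcontfun (S f) y = apply_bcontfun (S g) y"
    if "f \<in> A" "g \<in> A" "apply_bcontfun f (\<Phi> y) = apply_bcontfun g (\<Phi> y)" for f g y
    using vanish[of "f - g" y] that A by (simp add: subspace_diff diff)
  have ex: "\<exists>f. f \<in> A \<and> norm f = norm u \<and> apply_bcontfun f x = u" for x u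
    using strong_boundary_value[OF A, of x u] boundary_A by (metis UNIV_I)
  define F where "F x u = (SOME f. f \<in> A \<and> norm f = norm u \<and> apply_bcontfun f x = u)" for x u
  have F: "F x u \<in> A" "norm (F x u) = norm u" "apply_bcontfun (F x u) x = u" for x u
    using someI_ex[OF ex[of u x]] unfolding F_def by auto
  define V where "V y u = apply_bcontfun (S (F (\<Phi> y) u)) y" for y u
  have V: "apply_bcontfun (S f) y = V y (apply_bcontfun f (\<Phi> y))" if "f \<in> A" for f y
    unfolding V_def using F that by (intro cong) auto
  have norm_V: "norm (V y u) \<le> norm u" for y u
    using norm_bounded[of "S (F (\<Phi> y) u)" y] F norm_S by (simp add: V_def)
  have bl: "bounded_linear (V y)" for y
  proof (rule bounded_linear_intro[of _ 1])
    show "V y (u + w) = V y u + V y w" for u w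
      using V[of "F (\<Phi> y) u + F (\<Phi> y) w" y] F A
      by (simp add: add subspace_add) (simp add: V_def)
    show "V y (r *\<^sub>R u) = r *\<^sub>R V y u" for r u
      using V[of "r *\<^sub>R F (\<Phi> y) u" y] F A
      by (simp add: scale subspace_scale) (simp add: V_def)
    show "norm (V y u) \<le> norm u * 1" for u
      using norm_V by simp
  qed
  have "continuous_on UNIV \<Phi>"
    unfolding continuous_on_topological
  proof (intro ballI allI impI)
    fix y0 U assume U: "open U" "\<Phi> y0 \<in> U"
    obtain h where h: "h \<in> A" "norm h = 1" "apply_bcontfun h (\<Phi> y0) = c y0"
      "\<And>z. z \<notin> U \<Longrightarrow> norm (apply_bcontfun h z) < 1/2"
      using strong_boundaryD[OF _ U, of A "1/2" "c y0"] boundary_A c by auto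
    \<comment> \<open>At \<open>y0\<close> the value of \<open>S h\<close> is \<open>v\<close>, of
      norm 1. Since \<open>V y\<close> does not increase norms, \<open>S h\<close> exceeds 1/2 in
      norm only at points that \<open>\<Phi>\<close> sends into \<open>U\<close>.\<close>
    define W where "W = {y. 1/2 < norm (apply_bcontfun (S h) y)}"
    have "open W"
      unfolding W_def by (intro open_Collect_less continuous_intros) auto
    moreover have "y0 \<in> W"
      using peak[OF h(1-3)] maximal_convex_singletonD(1)[OF v] by (simp add: W_def)
    moreover have "\<Phi> y \<in> U" if "y \<in> W" for y
    proof (rule ccontr)
      assume "\<Phi> y \<notin> U"
      from h(4)[OF this] show False
        using that norm_V[of y "apply_bcontfun h (\<Phi> y)"] V[OF h(1), of y] by (simp add: W_def)
    qed
    ultimately show "\<exists>W. open W \<and> y0 \<in> W \<and> (\<forall>y\<in>UNIV. y \<in> W \<longrightarrow> \<Phi> y \<in> U)"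
      by blast
  qed
  then show thesis
  proof (rule that[of \<Phi> "\<lambda>y. Blinfun (V y)"])
    show "norm (Blinfun (V y)) \<le> 1" for y
      using norm_V by (intro norm_blinfun_bound) (simp_all add: bounded_linear_Blinfun_apply bl)
    show "apply_bcontfun (S f) y = blinfun_apply (Blinfun (V y)) (apply_bcontfun f (\<Phi> y))"
      if "f \<in> A" for f y
      using V[OF that] by (simp add: bounded_linear_Blinfun_apply bl)
  qed
qed

end

section \<open>Reduction to real scalars and proof of the theorem\<close>

text \<open>The Mazur-Ulam argument gives real linearity, so the proof runs over the reals, which
  act through \<open>of_real\<close>.\<close>

lemma subspace_over_imp_subspace:
  fixes scl :: "'k::real_or_complex \<Rightarrow> 'e::banach \<Rightarrow> 'e"
    and A :: "('x::topological_space \<Rightarrow>\<^sub>C 'e) set"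
  assumes "banach_over scl" "subspace_over scl A"
  shows "subspace A"
proof -
  interpret banach_over scl by fact
  interpret m: module "scale_bcontfun scl :: 'k \<Rightarrow> ('x \<Rightarrow>\<^sub>C 'e) \<Rightarrow> _"
    by (rule module_scale_bcontfun)
  have "scale_bcontfun scl (of_real r) f = r *\<^sub>R f" for r and f :: "'x \<Rightarrow>\<^sub>C 'e"
    by (rule bcontfun_eqI) (simp add: scale_of_real)
  then show ?thesis
    using assms(2) unfolding subspace_over_def m.subspace_def real_vector.subspace_def by metis
qed

text \<open>A function peaking at \<open>x\<close> can be made small at any other point. This will
  identify \<open>\<Phi>\<close> and \<open>\<Psi>\<close> as mutually inverse.\<close>

lemma bcontfun_dominated_imp_eq:
  fixes A :: "('x::t2_space \<Rightarrow>\<^sub>C 'e::real_normed_vector) set"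
  assumes x: "x \<in> strong_boundary A" and u: "norm (u :: 'e) = 1"
    and le: "\<And>f. f \<in> A \<Longrightarrow> norm (apply_bcontfun f x) \<le> norm (apply_bcontfun f x')"
  shows "x' = x"
proof (rule ccontr)
  assume "x' \<noteq> x"
  then obtain f where "f \<in> A" "apply_bcontfun f x = u" "norm (apply_bcontfun f x') < 1"
    using strong_boundaryD[OF x, of "- {x'}" 1 u] u by auto
  then show False using le u by fastforce
qed

theorem theorem3p10:
  fixes scaleE :: "'k::real_or_complex \<Rightarrow> 'e::banach \<Rightarrow> 'e"
    and scaleF :: "'k \<Rightarrow> 'f::banach \<Rightarrow> 'f"
    and A :: "('x::t2_space \<Rightarrow>\<^sub>C 'e) set"
    and B :: "('y::t2_space \<Rightarrow>\<^sub>C 'f) set"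
    and T :: "('x \<Rightarrow>\<^sub>C 'e) \<Rightarrow> ('y \<Rightarrow>\<^sub>C 'f)"
  assumes compact_X: "compact (UNIV :: 'x set)"
    and compact_Y: "compact (UNIV :: 'y set)"
    and E: "banach_over scaleE"
    and F: "banach_over scaleF"
    and singleton_F: "\<exists>v :: 'f. {v} \<in> maximal_convex_sphere_sets"
    and A: "subspace_over scaleE A"
    and B: "subspace_over scaleF B"
    and boundary_A: "strong_boundary A = UNIV"
    and boundary_B: "strong_boundary B = UNIV"
    and surj_T: "T ` A = B"
    and isometry_T: "\<forall>f\<in>A. \<forall>g\<in>A. norm (T f - T g) = norm (f - g)"
  shows "\<exists>(\<Phi> :: 'y \<Rightarrow> 'x) (V :: 'y \<Rightarrow> 'e \<Rightarrow>\<^sub>L 'f).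
    continuous_on UNIV \<Phi> \<and>
    (\<forall>y. norm (V y) \<le> 1) \<and>
    (\<forall>f\<in>A. \<forall>y. apply_bcontfun (T f) y =
       apply_bcontfun (T 0) y + blinfun_apply (V y) (apply_bcontfun f (\<Phi> y))) \<and>
    ((\<exists>u :: 'e. {u} \<in> maximal_convex_sphere_sets) \<longrightarrow>
       (\<exists>\<Psi>. homeomorphism UNIV UNIV \<Phi> \<Psi>) \<and>
       (\<forall>y a b. norm (blinfun_apply (V y) a - blinfun_apply (V y) b) = norm (a - b)))"
proof -
  have sA: "subspace A" and sB: "subspace B"
    using subspace_over_imp_subspace E F A B by blast+
  have T0: "T 0 \<in> B"
    using surj_T subspace_0[OF sA] by blast
  define S where "S f = T f - T 0" for f
  have S_surj: "S ` A = B"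
  proof
    show "S ` A \<subseteq> B"
      using surj_T T0 sB by (auto simp: S_def subspace_diff)
    show "B \<subseteq> S ` A"
    proof
      fix g assume "g \<in> B"
      then obtain f where "f \<in> A" "T f = g + T 0"
        using surj_T T0 subspace_add[OF sB] by (metis imageE)
      then show "g \<in> S ` A"
        by (intro image_eqI[of _ _ f]) (simp_all add: S_def)
    qed
  qed
  have S_iso: "norm (S f - S g) = norm (f - g)" if "f \<in> A" "g \<in> A" for f g
    using isometry_T that by (simp add: S_def)
  have S0: "S 0 = 0" by (simp add: S_def)
  note S_linear = mazur_ulam_subspace[OF sA sB S_surj S_iso S0]
  have norm_S: "norm (S f) = norm f" if "f \<in> A" for f
    using S_iso[OF that subspace_0[OF sA]] by (simp add: S0)
  interpret S: linear_isometry_bcontfun A B S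
    by unfold_locales
      (use compact_X sA sB boundary_A boundary_B S_surj S_linear norm_S in auto)
  obtain \<Phi> V where \<Phi>: "continuous_on UNIV \<Phi>" and V: "\<And>y. norm (V y) \<le> 1"
    and S: "\<And>f y. f \<in> A \<Longrightarrow>
      apply_bcontfun (S f) y = blinfun_apply (V y) (apply_bcontfun f (\<Phi> y))"
    using S.weighted_composition[OF singleton_F] by metis
  have blinfun_le: "norm (blinfun_apply W u) \<le> norm u" if "norm W \<le> 1"
    for W :: "'a::real_normed_vector \<Rightarrow>\<^sub>L 'b::real_normed_vector" and u
    using order_trans[OF norm_blinfun mult_right_mono[OF that norm_ge_zero]] by simp
  have S_le: "norm (apply_bcontfun (S f) y) \<le> norm (apply_bcontfun f (\<Phi> y))" if "f \<in> A" for f y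
    using S[OF that] blinfun_le[OF V] by simp
  have "(\<exists>\<Psi>. homeomorphism UNIV UNIV \<Phi> \<Psi>) \<and>
       (\<forall>y a b. norm (blinfun_apply (V y) a - blinfun_apply (V y) b) = norm (a - b))"
    if singleton_E: "\<exists>u :: 'e. {u} \<in> maximal_convex_sphere_sets"
  proof -
    obtain u :: 'e where u: "norm u = 1"
      using singleton_E maximal_convex_singletonD(1) by blast
    obtain v :: 'f where v: "norm v = 1"
      using singleton_F maximal_convex_singletonD(1) by blast
    define R where "R = inv_into A S"
    have inj: "inj_on S A"
      using S_iso by (fastforce intro: inj_onI)
    have RS: "R (S f) = f" if "f \<in> A" for f
      using inj that by (simp add: R_def)
    have RA: "R g \<in> A" and SR: "S (R g) = g" if "g \<in> B" for g
      using S_surj that by (auto simp: R_def inv_into_into f_inv_into_f)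
    have SB: "S f \<in> B" if "f \<in> A" for f
      using S_surj that by auto
    \<comment> \<open>The inverse meets the same assumptions with the roles exchanged; the singleton
      for \<open>E\<close> then yields its weighted composition form.\<close>
    interpret R: linear_isometry_bcontfun B A R
    proof unfold_locales
      show "R ` B = A"
        unfolding R_def using inj S_surj inv_into_image_cancel by blast
      show "R (f + g) = R f + R g" if "f \<in> B" "g \<in> B" for f g
        using RS[of "R f + R g"] that RA SR sA by (simp add: S_linear subspace_add)
      show "R (r *\<^sub>R f) = r *\<^sub>R R f" if "f \<in> B" for f r
        using RS[of "r *\<^sub>R R f"] that RA SR sA by (simp add: S_linear subspace_scale)
      show "norm (R f) = norm f" if "f \<in> B" for f
        using norm_S[OF RA[OF that]] SR[OF that] by simp
    qed (use compact_Y sA sB boundary_A boundary_B in auto)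
    obtain \<Psi> W where \<Psi>: "continuous_on UNIV \<Psi>" and W: "\<And>x. norm (W x) \<le> 1"
      and R: "\<And>g x. g \<in> B \<Longrightarrow>
        apply_bcontfun (R g) x = blinfun_apply (W x) (apply_bcontfun g (\<Psi> x))"
      using R.weighted_composition[OF singleton_E] by metis
    have R_le: "norm (apply_bcontfun f x) \<le> norm (apply_bcontfun (S f) (\<Psi> x))" if "f \<in> A" for f x
      using R[OF SB[OF that], of x] blinfun_le[OF W] by (simp add: RS that)
    \<comment> \<open>Passing from \<open>f\<close> to \<open>S f\<close> and back compares the norm
      of \<open>f\<close> at \<open>x\<close> with its norm at
      \<open>\<Phi> (\<Psi> x)\<close>.\<close>
    have \<Phi>\<Psi>: "\<Phi> (\<Psi> x) = x" for x
    proof (rule bcontfun_dominated_imp_eq[of x A u])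
      show "norm (apply_bcontfun f x) \<le> norm (apply_bcontfun f (\<Phi> (\<Psi> x)))" if "f \<in> A" for f
        using R_le[OF that] S_le[OF that] by (rule order_trans)
    qed (use boundary_A u in auto)
    have \<Psi>\<Phi>: "\<Psi> (\<Phi> y) = y" for y
    proof (rule bcontfun_dominated_imp_eq[of y B v])
      fix g assume g: "g \<in> B"
      show "norm (apply_bcontfun g y) \<le> norm (apply_bcontfun g (\<Psi> (\<Phi> y)))"
        using order_trans[OF S_le R_le, OF RA RA, OF g g] by (simp add: SR g)
    qed (use boundary_B v in auto)
    have "homeomorphism UNIV UNIV \<Phi> \<Psi>"
      using \<Phi> \<Psi> \<Phi>\<Psi> \<Psi>\<Phi> by (intro homeomorphismI) auto
    moreover have "norm (blinfun_apply (V y) a) = norm a" for y a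
    proof (rule antisym)
      show "norm (blinfun_apply (V y) a) \<le> norm a"
        using blinfun_le[OF V] .
      obtain f where f: "f \<in> A" "apply_bcontfun f (\<Phi> y) = a"
        using strong_boundary_value[OF sA, of "\<Phi> y" a] boundary_A by auto
      \<comment> \<open>Because \<open>\<Psi> (\<Phi> y) = y\<close>, the estimate for the inverse
        bounds \<open>f (\<Phi> y) = a\<close> by \<open>S f y\<close>, which is \<open>V y\<close>
        applied to \<open>a\<close>.\<close>
      show "norm a \<le> norm (blinfun_apply (V y) a)"
        using R_le[OF f(1), of "\<Phi> y"] by (simp add: S f \<Psi>\<Phi>)
    qed
    ultimately show ?thesis
      by (metis blinfun.diff_right)
  qed
  moreover have "apply_bcontfun (T f) y =
      apply_bcontfun (T 0) y + blinfun_apply (V y) (apply_bcontfun f (\<Phi> y))" if "f \<in> A" for f y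
    using S[OF that, of y] by (simp add: S_def algebra_simps)
  ultimately show ?thesis
    using \<Phi> V by blast
qed

end
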